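(* Let $f:A\to B$ and $g:A\to C$ be homomorphisms of commutative rings and let $J\subseteq B$, $J'\subseteq C$ be ideals with $f^{-1}(J)=g^{-1}(J')$. Assume that $J$ and $J'$ are generated by $\{j_\mu\}_{\mu\in M}$ and $\{j'_\nu\}_{\nu\in N}$ respectively as $A$-modules. Then $A\bowtie^{f,g}(J,J')$ is a homomorphic image of the polynomial ring $A[\{x_\mu\}_{\mu\in M},\{x'_\nu\}_{\nu\in N}]$, where $x_\mu$ and $x'_\nu$ are indeterminates.
   Context: All rings are commutative with identity. The bi-amalgamation is the subring $A\bowtie^{f,g}(J,J')=\{(f(a)+j,\,g(a)+j') : a\in A,\ (j,j')\in J\times J'\}$ of $B\times C$. $J$ and $J'$ are $A$-modules via $f$ and $g$ respectively. *)

theory Defs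
  imports "HOL-Algebra.Indexed_Polynomials" "HOL-Algebra.Chinese_Remainder"
begin

text \<open>The carrier, constants and addition are those of \<^theory>\<open>HOL-Algebra.Indexed_Polynomials\<close>:
  a polynomial maps each monomial (a multiset of indices in \<open>I\<close>) to its coefficient. That theory
  lacks the product, which is added here as the Cauchy product; its index set is finite because a
  multiset has finitely many submultisets.\<close>

definition poly_ring_mult ::
  "('a, 'r) ring_scheme \<Rightarrow> ('c multiset \<Rightarrow> 'a) \<Rightarrow> ('c multiset \<Rightarrow> 'a) \<Rightarrow> ('c multiset \<Rightarrow> 'a)"
  where "poly_ring_mult R p q =
    (\<lambda>m. \<Oplus>\<^bsub>R\<^esub>u \<in> {u. u \<subseteq># m}. p u \<otimes>\<^bsub>R\<^esub> q (m - u))"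

definition indexed_poly_ring :: "('a, 'r) ring_scheme \<Rightarrow> 'c set \<Rightarrow> ('c multiset \<Rightarrow> 'a) ring"
  where "indexed_poly_ring R I =
    \<lparr> carrier = ring.indexed_pset R I (carrier R),
      monoid.mult = poly_ring_mult R,
      monoid.one = ring.indexed_const R \<one>\<^bsub>R\<^esub>,
      ring.zero = ring.indexed_const R \<zero>\<^bsub>R\<^esub>,
      ring.add = ring.indexed_padd R \<rparr>"

lemma finite_submultisets: "finite {u. u \<subseteq># (m :: 'c multiset)}"
proof (induction m)
  case (add x m)
  have "{u. u \<subseteq># add_mset x m} \<subseteq> {u. u \<subseteq># m} \<union> add_mset x ` {u. u \<subseteq># m}"
  proof
    fix u assume u: "u \<in> {u. u \<subseteq># add_mset x m}"
    show "u \<in> {u. u \<subseteq># m} \<union> add_mset x ` {u. u \<subseteq># m}"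
    proof (cases "x \<in># u")
      case True
      then obtain v where "u = add_mset x v" by (metis insert_DiffM)
      with u show ?thesis by auto
    next
      case False
      with u show ?thesis
        by (auto simp: subseteq_mset_def not_in_iff split: if_splits)
          (metis count_add_mset le_zero_eq nat_le_linear)
    qed
  qed
  then show ?case
    by (rule finite_subset) (use add in simp)
qed auto

context cring
begin

lemma poly_ring_mult_in_carrier:
  assumes "carrier_coeff p" "carrier_coeff q"
  shows "carrier_coeff (poly_ring_mult R p q)"
  using assms by (auto simp: carrier_coeff_def poly_ring_mult_def intro!: finsum_closed)

lemma poly_ring_mult_comm:
  fixes p q :: "'c multiset \<Rightarrow> 'a"
  assumes "carrier_coeff p" "carrier_coeff q"
  shows "poly_ring_mult R p q = poly_ring_mult R q p"
proof
  fix m :: "'c multiset"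
  have pq: "\<And>u. p u \<in> carrier R" "\<And>u. q u \<in> carrier R"
    using assms by (auto simp: carrier_coeff_def)
  have "bij_betw (\<lambda>u. m - u) {u. u \<subseteq># m} {u. u \<subseteq># m}"
    by (rule bij_betw_byWitness[where f' = "\<lambda>u. m - u"])
      (auto simp: multiset_eq_iff subseteq_mset_def)
  then have "{u. u \<subseteq># m} = (\<lambda>u. m - u) ` {u. u \<subseteq># m}" "inj_on (\<lambda>u. m - u) {u. u \<subseteq># m}"
    by (auto simp: bij_betw_def)
  then have "poly_ring_mult R p q m = (\<Oplus>u \<in> {u. u \<subseteq># m}. p (m - u) \<otimes> q (m - (m - u)))"
    unfolding poly_ring_mult_def
    using finsum_reindex[of "\<lambda>u. p u \<otimes> q (m - u)" "\<lambda>u. m - u" "{u. u \<subseteq># m}"] pq by auto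
  also have "\<dots> = poly_ring_mult R q p m"
    unfolding poly_ring_mult_def
  proof (rule finsum_cong', goal_cases)
    case (3 u)
    then have "m - (m - u) = u"
      by (auto simp: multiset_eq_iff subseteq_mset_def)
    with pq show ?case by (simp add: m_comm)
  qed (use pq in auto)
  finally show "poly_ring_mult R p q m = poly_ring_mult R q p m" .
qed

lemma poly_ring_mult_const:
  fixes q :: "'c multiset \<Rightarrow> 'a"
  assumes "k \<in> carrier R" "carrier_coeff q"
  shows "poly_ring_mult R (indexed_const k) q = (\<lambda>m. k \<otimes> q m)"
proof
  fix m :: "'c multiset"
  have q: "\<And>u. q u \<in> carrier R"
    using assms by (auto simp: carrier_coeff_def)
  have "poly_ring_mult R (indexed_const k) q m =
      (\<Oplus>u \<in> {u. u \<subseteq># m}. if {#} = u then k \<otimes> q (m - u) else \<zero>)"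
    unfolding poly_ring_mult_def
    by (rule finsum_cong') (use assms q in \<open>auto simp: indexed_const_def\<close>)
  also have "\<dots> = k \<otimes> q (m - {#})"
    by (rule add.finprod_singleton) (use assms q finite_submultisets in auto)
  finally show "poly_ring_mult R (indexed_const k) q m = k \<otimes> q m" by simp
qed

lemma poly_ring_mult_padd:
  fixes p p' q :: "'c multiset \<Rightarrow> 'a"
  assumes "carrier_coeff p" "carrier_coeff p'" "carrier_coeff q"
  shows "poly_ring_mult R (indexed_padd p p') q =
    indexed_padd (poly_ring_mult R p q) (poly_ring_mult R p' q)"
proof
  fix m :: "'c multiset"
  have pq: "\<And>u. p u \<in> carrier R" "\<And>u. p' u \<in> carrier R" "\<And>u. q u \<in> carrier R"
    using assms by (auto simp: carrier_coeff_def)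
  then show "poly_ring_mult R (indexed_padd p p') q m =
      indexed_padd (poly_ring_mult R p q) (poly_ring_mult R p' q) m"
    unfolding poly_ring_mult_def indexed_padd_def
    by (subst finsum_addf[symmetric]) (auto simp: l_distr)
qed

lemma poly_ring_mult_pmult:
  fixes p q :: "'c multiset \<Rightarrow> 'a"
  assumes "carrier_coeff p" "carrier_coeff q"
  shows "poly_ring_mult R (indexed_pmult p i) q = indexed_pmult (poly_ring_mult R p q) i"
proof
  fix m :: "'c multiset"
  have pq: "\<And>u. p u \<in> carrier R" "\<And>u. q u \<in> carrier R"
    using assms by (auto simp: carrier_coeff_def)
  show "poly_ring_mult R (indexed_pmult p i) q m = indexed_pmult (poly_ring_mult R p q) i m"
  proof (cases "i \<in># m")
    case True
    let ?S = "add_mset i ` {u. u \<subseteq># m - {#i#}}"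
    have sub: "?S \<subseteq> {u. u \<subseteq># m}"
      using True by (auto simp: insert_subset_eq_iff)
    have "(\<Oplus>u \<in> {u. u \<subseteq># m}. indexed_pmult p i u \<otimes> q (m - u)) =
      (\<Oplus>u \<in> ?S. indexed_pmult p i u \<otimes> q (m - u))"
    proof (rule add.finprod_mono_neutral_cong_right[OF finite_submultisets sub])
      fix u assume u: "u \<in> {u. u \<subseteq># m} - ?S"
      have "i \<notin># u"
      proof
        assume "i \<in># u"
        then obtain v where "u = add_mset i v" by (metis insert_DiffM)
        with u show False by (auto simp: insert_subset_eq_iff)
      qed
      with pq show "indexed_pmult p i u \<otimes> q (m - u) = \<zero>"
        by (simp add: indexed_pmult_def)
    qed (use pq in \<open>auto simp: indexed_pmult_def\<close>)
    also have "\<dots> = (\<Oplus>u \<in> {u. u \<subseteq># m - {#i#}}.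
        indexed_pmult p i (add_mset i u) \<otimes> q (m - add_mset i u))"
      by (rule finsum_reindex) (use pq in \<open>auto simp: indexed_pmult_def inj_on_def\<close>)
    also have "\<dots> = (\<Oplus>u \<in> {u. u \<subseteq># m - {#i#}}. p u \<otimes> q (m - {#i#} - u))"
      by (rule finsum_cong') (use pq in \<open>auto simp: indexed_pmult_def\<close>)
    finally show ?thesis
      using True by (simp add: poly_ring_mult_def indexed_pmult_def)
  next
    case False
    have "(\<Oplus>u \<in> {u. u \<subseteq># m}. indexed_pmult p i u \<otimes> q (m - u)) = \<zero>"
    proof (rule add.finprod_one_eqI)
      fix u assume "u \<in> {u. u \<subseteq># m}"
      with False have "i \<notin># u" by (auto dest: mset_subset_eqD)
      with pq show "indexed_pmult p i u \<otimes> q (m - u) = \<zero>"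
        by (simp add: indexed_pmult_def)
    qed
    with False show ?thesis
      by (simp add: poly_ring_mult_def indexed_pmult_def)
  qed
qed

lemma indexed_poly_ring_cring:
  fixes I :: "'c set"
  shows "cring (indexed_poly_ring R I)"
proof -
  let ?P = "indexed_pset I (carrier R)"
  have cc: "carrier_coeff p" if "p \<in> ?P" for p :: "'c multiset \<Rightarrow> 'a"
    using indexed_pset_in_carrier[OF subset_refl that] .
  have val: "p m \<in> carrier R" if "p \<in> ?P" for p m
    using cc[OF that] by (simp add: carrier_coeff_def)
  have const_cc: "carrier_coeff (indexed_const k)" if "k \<in> carrier R" for k
    using that by (simp add: carrier_coeff_def indexed_const_def)
  have scale: "(\<lambda>m. k \<otimes> q m) \<in> ?P" if "k \<in> carrier R" "q \<in> ?P" for k q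
    using that(2)
  proof induction
    case (indexed_const l)
    have "(\<lambda>m :: 'c multiset. k \<otimes> indexed_const l m) = indexed_const (k \<otimes> l)"
      using that(1) by (auto simp: indexed_const_def)
    with that(1) indexed_const show ?case by (simp only: indexed_pset.indexed_const m_closed)
  next
    case (indexed_padd p q)
    have "(\<lambda>m. k \<otimes> indexed_padd p q m) = indexed_padd (\<lambda>m. k \<otimes> p m) (\<lambda>m. k \<otimes> q m)"
      using that(1) indexed_padd val by (auto simp: indexed_padd_def r_distr)
    with indexed_padd show ?case by (simp only: indexed_pset.indexed_padd)
  next
    case (indexed_pmult p i)
    have "(\<lambda>m. k \<otimes> indexed_pmult p i m) = indexed_pmult (\<lambda>m. k \<otimes> p m) i"
      using that(1) by (auto simp: indexed_pmult_def)
    with indexed_pmult show ?case by (simp only: indexed_pset.indexed_pmult)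
  qed
  have closed: "poly_ring_mult R p q \<in> ?P" if "p \<in> ?P" "q \<in> ?P" for p q
    using that(1)
  proof induction
    case (indexed_const k)
    with that(2) show ?case by (simp add: poly_ring_mult_const cc scale)
  next
    case (indexed_padd p p')
    with that(2) show ?case
      by (simp add: poly_ring_mult_padd cc indexed_pset.indexed_padd)
  next
    case (indexed_pmult p i)
    with that(2) show ?case
      by (simp add: poly_ring_mult_pmult cc indexed_pset.indexed_pmult)
  qed
  have assoc: "poly_ring_mult R (poly_ring_mult R p q) r = poly_ring_mult R p (poly_ring_mult R q r)"
    if "p \<in> ?P" "q \<in> ?P" "r \<in> ?P" for p q r
    using that(1)
  proof induction
    case (indexed_const k)
    have "poly_ring_mult R (\<lambda>m. k \<otimes> q m) r = (\<lambda>m. k \<otimes> poly_ring_mult R q r m)"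
      using indexed_const that val
      by (auto simp: poly_ring_mult_def finsum_rdistr finite_submultisets m_assoc fun_eq_iff)
    with indexed_const that show ?case
      by (simp add: poly_ring_mult_const cc closed)
  next
    case (indexed_padd p p')
    with that show ?case by (simp add: poly_ring_mult_padd cc closed)
  next
    case (indexed_pmult p i)
    with that show ?case by (simp add: poly_ring_mult_pmult cc closed)
  qed
  have one: "poly_ring_mult R (indexed_const \<one>) p = p" if "p \<in> ?P" for p
    using that val by (simp add: poly_ring_mult_const cc)
  show ?thesis
  proof (rule cringI)
    show "abelian_group (indexed_poly_ring R I)"
    proof (rule abelian_groupI)
      fix p assume p: "p \<in> carrier (indexed_poly_ring R I)"
      have "indexed_padd (\<lambda>m. \<ominus> \<one> \<otimes> p m) p = indexed_const \<zero>"
        using p val by (auto simp: indexed_poly_ring_def indexed_padd_def indexed_const_def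
            l_minus l_neg)
      with p scale[of "\<ominus> \<one>" p] show "\<exists>q\<in>carrier (indexed_poly_ring R I).
          q \<oplus>\<^bsub>indexed_poly_ring R I\<^esub> p = \<zero>\<^bsub>indexed_poly_ring R I\<^esub>"
        by (auto simp: indexed_poly_ring_def intro!: bexI[of _ "\<lambda>m. \<ominus> \<one> \<otimes> p m"])
    next
      fix p assume "p \<in> carrier (indexed_poly_ring R I)"
      then show "\<zero>\<^bsub>indexed_poly_ring R I\<^esub> \<oplus>\<^bsub>indexed_poly_ring R I\<^esub> p = p"
        by (simp add: indexed_poly_ring_def indexed_padd_zero cc)
    qed (auto simp: indexed_poly_ring_def cc val indexed_padd_def a_ac
          intro: indexed_pset.indexed_padd[unfolded indexed_padd_def] indexed_pset.indexed_const)
    show "comm_monoid (indexed_poly_ring R I)"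
      by (rule comm_monoidI)
        (auto simp: indexed_poly_ring_def closed assoc one cc
          intro: indexed_pset.indexed_const poly_ring_mult_comm)
  qed (auto simp: indexed_poly_ring_def poly_ring_mult_padd cc)
qed

end

definition bi_amalgamation ::
  "('a, 'r) ring_scheme \<Rightarrow> ('b, 's) ring_scheme \<Rightarrow> ('c, 't) ring_scheme \<Rightarrow>
   ('a \<Rightarrow> 'b) \<Rightarrow> ('a \<Rightarrow> 'c) \<Rightarrow> 'b set \<Rightarrow> 'c set \<Rightarrow> ('b \<times> 'c) ring"
  where "bi_amalgamation A B C f g J J' =
    (RDirProd B C)
      \<lparr> carrier := {(f a \<oplus>\<^bsub>B\<^esub> j, g a \<oplus>\<^bsub>C\<^esub> j') | a j j'. a \<in> carrier A \<and> (j, j') \<in> J \<times> J'} \<rparr>"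

text \<open>An ideal \<open>J\<close> of \<open>B\<close> as a module via \<open>f\<close>. The record type for modules extends that for rings,
  so multiplication and unit have to be supplied, but they play no role for modules.\<close>

definition ideal_module :: "('a \<Rightarrow> 'b) \<Rightarrow> ('b, 's) ring_scheme \<Rightarrow> 'b set \<Rightarrow> ('a, 'b) module"
  where "ideal_module f B J =
    \<lparr> carrier = J, monoid.mult = (\<otimes>\<^bsub>B\<^esub>), monoid.one = \<one>\<^bsub>B\<^esub>, ring.zero = \<zero>\<^bsub>B\<^esub>, ring.add = (\<oplus>\<^bsub>B\<^esub>),
      smult = (\<lambda>a x. f a \<otimes>\<^bsub>B\<^esub> x) \<rparr>"

definition module_generated_by ::
  "('a, 'r) ring_scheme \<Rightarrow> ('a, 'b, 's) module_scheme \<Rightarrow> ('i \<Rightarrow> 'b) \<Rightarrow> 'i set \<Rightarrow> bool"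
  where "module_generated_by R M x I \<longleftrightarrow>
    x \<in> I \<rightarrow> carrier M \<and> carrier M = \<Inter> {H. submodule H R M \<and> x ` I \<subseteq> H}"

lemma ideal_module_is_module:
  assumes "cring A" "cring B" "f \<in> ring_hom A B" "ideal J B"
  shows "module A (ideal_module f B J)"
proof -
  interpret A: cring A by fact
  interpret B: cring B by fact
  interpret J: ideal J B by fact
  interpret f: ring_hom_cring A B f
    using assms(3) by unfold_locales
  have sub: "\<And>x. x \<in> J \<Longrightarrow> x \<in> carrier B"
    using J.a_subset by blast
  have ag: "abelian_group (ideal_module f B J)"
  proof (rule abelian_groupI)
    fix x assume "x \<in> carrier (ideal_module f B J)"
    then show "\<exists>y\<in>carrier (ideal_module f B J).
        y \<oplus>\<^bsub>ideal_module f B J\<^esub> x = \<zero>\<^bsub>ideal_module f B J\<^esub>"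
      by (auto simp: ideal_module_def intro!: bexI[of _ "\<ominus>\<^bsub>B\<^esub> x"] B.l_neg sub J.a_inv_closed)
  qed (auto simp: ideal_module_def sub B.a_ac J.a_closed intro: J.zero_closed)
  show ?thesis
    by (rule moduleI[OF \<open>cring A\<close> ag])
      (auto simp: ideal_module_def sub B.l_distr B.r_distr B.m_assoc J.I_l_closed)
qed

lemma bi_amalgamation_subring:
  assumes "cring A" "cring B" "cring C" "f \<in> ring_hom A B" "g \<in> ring_hom A C"
    and "ideal J B" "ideal J' C"
  shows "subring (carrier (bi_amalgamation A B C f g J J')) (RDirProd B C)"
proof -
  interpret A: cring A by fact
  interpret B: cring B by fact
  interpret C: cring C by fact
  interpret J: ideal J B by fact
  interpret J': ideal J' C by fact
  interpret f: ring_hom_cring A B f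
    using assms(4) by unfold_locales
  interpret g: ring_hom_cring A C g
    using assms(5) by unfold_locales
  interpret P: ring "RDirProd B C"
    by (rule RDirProd_ring) unfold_locales
  have sub: "\<And>x. x \<in> J \<Longrightarrow> x \<in> carrier B" "\<And>x. x \<in> J' \<Longrightarrow> x \<in> carrier C"
    using J.a_subset J'.a_subset by blast+
  let ?S = "{(f a \<oplus>\<^bsub>B\<^esub> j, g a \<oplus>\<^bsub>C\<^esub> j') | a j j'. a \<in> carrier A \<and> (j, j') \<in> J \<times> J'}"
  have carr: "carrier (bi_amalgamation A B C f g J J') = ?S"
    by (simp add: bi_amalgamation_def)
  have "subring ?S (RDirProd B C)"
  proof (rule P.subringI)
    show "?S \<subseteq> carrier (RDirProd B C)"
      by (auto simp: RDirProd_carrier sub)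
    have "\<one>\<^bsub>RDirProd B C\<^esub> = (f \<one>\<^bsub>A\<^esub> \<oplus>\<^bsub>B\<^esub> \<zero>\<^bsub>B\<^esub>, g \<one>\<^bsub>A\<^esub> \<oplus>\<^bsub>C\<^esub> \<zero>\<^bsub>C\<^esub>)"
      by (simp add: RDirProd_def DirProd_def monoid.defs)
    then show "\<one>\<^bsub>RDirProd B C\<^esub> \<in> ?S"
      using J.zero_closed J'.zero_closed A.one_closed by blast
  next
    fix h assume "h \<in> ?S"
    then obtain a j j' where h: "h = (f a \<oplus>\<^bsub>B\<^esub> j, g a \<oplus>\<^bsub>C\<^esub> j')"
      and a: "a \<in> carrier A" "j \<in> J" "j' \<in> J'" by auto
    let ?n = "(f (\<ominus>\<^bsub>A\<^esub> a) \<oplus>\<^bsub>B\<^esub> \<ominus>\<^bsub>B\<^esub> j, g (\<ominus>\<^bsub>A\<^esub> a) \<oplus>\<^bsub>C\<^esub> \<ominus>\<^bsub>C\<^esub> j')"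
    have "?n \<oplus>\<^bsub>RDirProd B C\<^esub> h = \<zero>\<^bsub>RDirProd B C\<^esub>"
    proof -
      have "f (\<ominus>\<^bsub>A\<^esub> a) \<oplus>\<^bsub>B\<^esub> \<ominus>\<^bsub>B\<^esub> j \<oplus>\<^bsub>B\<^esub> (f a \<oplus>\<^bsub>B\<^esub> j) = \<zero>\<^bsub>B\<^esub>"
        using a sub by (simp add: B.minus_add[symmetric] B.l_neg)
      moreover have "g (\<ominus>\<^bsub>A\<^esub> a) \<oplus>\<^bsub>C\<^esub> \<ominus>\<^bsub>C\<^esub> j' \<oplus>\<^bsub>C\<^esub> (g a \<oplus>\<^bsub>C\<^esub> j') = \<zero>\<^bsub>C\<^esub>"
        using a sub by (simp add: C.minus_add[symmetric] C.l_neg)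
      ultimately show ?thesis
        by (simp add: h RDirProd_def DirProd_def monoid.defs)
    qed
    then have "\<ominus>\<^bsub>RDirProd B C\<^esub> h = ?n"
      using a sub by (intro P.minus_equality) (auto simp: h RDirProd_carrier)
    then show "\<ominus>\<^bsub>RDirProd B C\<^esub> h \<in> ?S"
      using a J.a_inv_closed J'.a_inv_closed A.a_inv_closed by blast
  next
    fix h1 h2 assume "h1 \<in> ?S" "h2 \<in> ?S"
    then obtain a j j' b k k' where h: "h1 = (f a \<oplus>\<^bsub>B\<^esub> j, g a \<oplus>\<^bsub>C\<^esub> j')"
        "h2 = (f b \<oplus>\<^bsub>B\<^esub> k, g b \<oplus>\<^bsub>C\<^esub> k')"
      and a: "a \<in> carrier A" "j \<in> J" "j' \<in> J'" "b \<in> carrier A" "k \<in> J" "k' \<in> J'" by auto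
    have "h1 \<otimes>\<^bsub>RDirProd B C\<^esub> h2 =
      (f (a \<otimes>\<^bsub>A\<^esub> b) \<oplus>\<^bsub>B\<^esub> (f a \<otimes>\<^bsub>B\<^esub> k \<oplus>\<^bsub>B\<^esub> j \<otimes>\<^bsub>B\<^esub> (f b \<oplus>\<^bsub>B\<^esub> k)),
       g (a \<otimes>\<^bsub>A\<^esub> b) \<oplus>\<^bsub>C\<^esub> (g a \<otimes>\<^bsub>C\<^esub> k' \<oplus>\<^bsub>C\<^esub> j' \<otimes>\<^bsub>C\<^esub> (g b \<oplus>\<^bsub>C\<^esub> k')))"
      using a sub
      by (simp add: h RDirProd_def DirProd_def monoid.defs B.l_distr B.r_distr C.l_distr C.r_distr
          B.a_ac C.a_ac)
    moreover have "f a \<otimes>\<^bsub>B\<^esub> k \<oplus>\<^bsub>B\<^esub> j \<otimes>\<^bsub>B\<^esub> (f b \<oplus>\<^bsub>B\<^esub> k) \<in> J"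
      "g a \<otimes>\<^bsub>C\<^esub> k' \<oplus>\<^bsub>C\<^esub> j' \<otimes>\<^bsub>C\<^esub> (g b \<oplus>\<^bsub>C\<^esub> k') \<in> J'"
      using a sub by (simp_all add: J.a_closed J'.a_closed J.I_l_closed J'.I_l_closed
          J.I_r_closed J'.I_r_closed)
    moreover have "a \<otimes>\<^bsub>A\<^esub> b \<in> carrier A" using a by simp
    ultimately show "h1 \<otimes>\<^bsub>RDirProd B C\<^esub> h2 \<in> ?S" by blast
    have "h1 \<oplus>\<^bsub>RDirProd B C\<^esub> h2 =
      (f (a \<oplus>\<^bsub>A\<^esub> b) \<oplus>\<^bsub>B\<^esub> (j \<oplus>\<^bsub>B\<^esub> k), g (a \<oplus>\<^bsub>A\<^esub> b) \<oplus>\<^bsub>C\<^esub> (j' \<oplus>\<^bsub>C\<^esub> k'))"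
      using a sub
      by (simp add: h RDirProd_def DirProd_def monoid.defs B.a_ac C.a_ac)
    moreover have "j \<oplus>\<^bsub>B\<^esub> k \<in> J" "j' \<oplus>\<^bsub>C\<^esub> k' \<in> J'" "a \<oplus>\<^bsub>A\<^esub> b \<in> carrier A"
      using a by (simp_all add: J.a_closed J'.a_closed)
    ultimately show "h1 \<oplus>\<^bsub>RDirProd B C\<^esub> h2 \<in> ?S" by blast
  qed
  then show ?thesis by (simp only: carr)
qed

end

theory Submission
  imports Defs
begin

text \<open>Evaluating at \<open>x\<^sub>\<mu> \<mapsto> (j\<^sub>\<mu>, 0)\<close> and \<open>x'\<^sub>\<nu> \<mapsto> (0, j'\<^sub>\<nu>)\<close> along \<open>a \<mapsto> (f a, g a)\<close> is a ring
  homomorphism \<open>e\<close> into the bi-amalgamation. The set of all \<open>y \<in> J\<close> with \<open>(y, 0)\<close> in the image of \<open>e\<close>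
  is an \<open>A\<close>-submodule of \<open>J\<close> containing the generators, hence all of \<open>J\<close>; likewise for \<open>J'\<close>. Since
  \<open>(f a + y, g a + y') = (f a, g a) + (y, 0) + (0, y')\<close>, the map \<open>e\<close> is onto.\<close>

section \<open>Finiteness of supports\<close>

text \<open>Elements of \<open>indexed_pset\<close> are functions on all monomials, so finiteness
  must be read off from how they are generated: a constant lives on the empty monomial, a sum on the
  union of the two supports, and multiplication by a variable shifts the support by
  \<open>add_mset i\<close>.\<close>

lemma (in cring) finite_indexed_poly_support:
  assumes "p \<in> indexed_pset I (carrier R)"
  shows "finite {m. p m \<noteq> \<zero>}"
  using assms
proof induction
  case (indexed_const k)
  show ?case
    by (rule finite_subset[of _ "{{#}}"]) (auto simp: indexed_const_def)
next
  case (indexed_padd p q)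
  show ?case
  proof (rule finite_subset)
    show "{m. indexed_padd p q m \<noteq> \<zero>} \<subseteq> {m. p m \<noteq> \<zero>} \<union> {m. q m \<noteq> \<zero>}"
      by (auto simp: indexed_padd_def)
  qed (use indexed_padd.IH in simp)
next
  case (indexed_pmult p i)
  show ?case
  proof (rule finite_subset)
    show "{m. indexed_pmult p i m \<noteq> \<zero>} \<subseteq> add_mset i ` {m. p m \<noteq> \<zero>}"
    proof
      fix m assume "m \<in> {m. indexed_pmult p i m \<noteq> \<zero>}"
      then have "i \<in># m" "p (m - {#i#}) \<noteq> \<zero>"
        by (auto simp: indexed_pmult_def split: if_splits)
      then show "m \<in> add_mset i ` {m. p m \<noteq> \<zero>}"
        by (intro image_eqI[of _ _ "m - {#i#}"]) auto
    qed
  qed (use indexed_pmult.IH in simp)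
qed

section \<open>Values of monomials\<close>

definition monomial_eval :: "('b, 's) ring_scheme \<Rightarrow> ('i \<Rightarrow> 'b) \<Rightarrow> 'i multiset \<Rightarrow> 'b"
  where "monomial_eval S x m = (\<Otimes>\<^bsub>S\<^esub>i \<in> set_mset m. x i [^]\<^bsub>S\<^esub> count m i)"

context cring
begin

lemma monomial_eval_closed [simp, intro]:
  assumes "range x \<subseteq> carrier R"
  shows "monomial_eval R x m \<in> carrier R"
  unfolding monomial_eval_def using assms by (intro finprod_closed) auto

lemma monomial_eval_empty [simp]: "monomial_eval R x {#} = \<one>"
  by (simp add: monomial_eval_def)

lemma monomial_eval_add_mset:
  assumes x: "range x \<subseteq> carrier R"
  shows "monomial_eval R x (add_mset i m) = monomial_eval R x m \<otimes> x i"
proof -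
  let ?F = "set_mset (add_mset i m)"
  have xc: "x k \<in> carrier R" for k using x by auto
  \<comment> \<open>The raised exponent at \<open>i\<close> is split off as a separate factor that
    is one at every other index, which avoids a case distinction on whether \<open>i\<close> already
    occurs in \<open>m\<close>.\<close>
  have "monomial_eval R x (add_mset i m) =
      (\<Otimes>k \<in> ?F. x k [^] count m k \<otimes> (if i = k then x k else \<one>))"
    unfolding monomial_eval_def by (rule finprod_cong') (use xc in auto)
  also have "\<dots> = (\<Otimes>k \<in> ?F. x k [^] count m k) \<otimes> (\<Otimes>k \<in> ?F. if i = k then x k else \<one>)"
    by (rule finprod_multf) (use xc in auto)
  also have "(\<Otimes>k \<in> ?F. if i = k then x k else \<one>) = x i"
    by (rule finprod_singleton) (use xc in auto)
  also have "(\<Otimes>k \<in> ?F. x k [^] count m k) = monomial_eval R x m"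
    unfolding monomial_eval_def
    by (rule finprod_mono_neutral_cong_right) (use xc in \<open>auto simp: not_in_iff\<close>)
  finally show ?thesis .
qed

end

section \<open>Evaluation of polynomials\<close>

text \<open>\<open>finsum\<close> over an infinite set defaults to zero, so this is the intended
  value only for finite support; hence the finiteness hypotheses of the additivity and scaling
  lemmas.\<close>

definition indexed_poly_eval ::
  "('a, 'r) ring_scheme \<Rightarrow> ('b, 's) ring_scheme \<Rightarrow> ('a \<Rightarrow> 'b) \<Rightarrow> ('i \<Rightarrow> 'b) \<Rightarrow> ('i multiset \<Rightarrow> 'a) \<Rightarrow> 'b"
  where "indexed_poly_eval R S h x p =
    (\<Oplus>\<^bsub>S\<^esub>m \<in> {m. p m \<noteq> \<zero>\<^bsub>R\<^esub>}. h (p m) \<otimes>\<^bsub>S\<^esub> monomial_eval S x m)"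

context ring_hom_cring
begin

context
  fixes x :: "'i \<Rightarrow> 'c"
  assumes x: "range x \<subseteq> carrier S"
begin

text \<open>Terms outside the support vanish because \<open>h\<close> preserves zero. This lets
  polynomials with different supports be summed over one index set.\<close>

lemma indexed_poly_eval_superset:
  assumes "R.carrier_coeff p" "finite F" "{m. p m \<noteq> \<zero>} \<subseteq> F"
  shows "indexed_poly_eval R S h x p = (\<Oplus>\<^bsub>S\<^esub>m \<in> F. h (p m) \<otimes>\<^bsub>S\<^esub> monomial_eval S x m)"
  unfolding indexed_poly_eval_def
  by (rule S.add.finprod_mono_neutral_cong_left)
    (use assms x in \<open>auto simp: R.carrier_coeff_def\<close>)

lemma indexed_poly_eval_closed:
  assumes "R.carrier_coeff p"
  shows "indexed_poly_eval R S h x p \<in> carrier S"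
  unfolding indexed_poly_eval_def
  using assms x by (intro S.finsum_closed) (auto simp: R.carrier_coeff_def)

lemma indexed_poly_eval_const:
  assumes "k \<in> carrier R"
  shows "indexed_poly_eval R S h x (R.indexed_const k) = h k"
proof -
  \<comment> \<open>The singleton may be larger than the support, since \<open>k\<close> can be
    zero.\<close>
  have "indexed_poly_eval R S h x (R.indexed_const k) =
      (\<Oplus>\<^bsub>S\<^esub>m \<in> {{#}}. h (R.indexed_const k m) \<otimes>\<^bsub>S\<^esub> monomial_eval S x m)"
    using assms
    by (intro indexed_poly_eval_superset) (auto simp: R.indexed_const_def R.carrier_coeff_def)
  also have "\<dots> = h k"
    using assms x by (simp add: R.indexed_const_def)
  finally show ?thesis .
qed

lemma indexed_poly_eval_padd:
  assumes "R.carrier_coeff p" "finite {m. p m \<noteq> \<zero>}" "R.carrier_coeff q" "finite {m. q m \<noteq> \<zero>}"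
  shows "indexed_poly_eval R S h x (R.indexed_padd p q) =
    indexed_poly_eval R S h x p \<oplus>\<^bsub>S\<^esub> indexed_poly_eval R S h x q"
proof -
  \<comment> \<open>A common index set for \<open>p\<close>, \<open>q\<close> and their sum, whose
    own support can be smaller by cancellation.\<close>
  let ?F = "{m. p m \<noteq> \<zero>} \<union> {m. q m \<noteq> \<zero>}"
  let ?t = "\<lambda>p m. h (p m) \<otimes>\<^bsub>S\<^esub> monomial_eval S x m"
  have val: "p m \<in> carrier R" "q m \<in> carrier R" for m
    using assms by (auto simp: R.carrier_coeff_def)
  have fin: "finite ?F" using assms by simp
  have "indexed_poly_eval R S h x (R.indexed_padd p q) = finsum S (?t (R.indexed_padd p q)) ?F"
    by (rule indexed_poly_eval_superset[OF R.indexed_padd_in_carrier[OF assms(1,3)] fin])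
      (auto simp: R.indexed_padd_def)
  also have "\<dots> = finsum S (\<lambda>m. ?t p m \<oplus>\<^bsub>S\<^esub> ?t q m) ?F"
    by (rule S.finsum_cong') (use val x in \<open>auto simp: R.indexed_padd_def S.l_distr\<close>)
  also have "\<dots> = finsum S (?t p) ?F \<oplus>\<^bsub>S\<^esub> finsum S (?t q) ?F"
    by (rule S.finsum_addf) (use val x in auto)
  also have "finsum S (?t p) ?F = indexed_poly_eval R S h x p"
    by (rule indexed_poly_eval_superset[symmetric]) (use assms fin in auto)
  also have "finsum S (?t q) ?F = indexed_poly_eval R S h x q"
    by (rule indexed_poly_eval_superset[symmetric]) (use assms fin in auto)
  finally show ?thesis .
qed

text \<open>The support is shifted along the injective map \<open>add_mset i\<close>, so the sum can
  be reindexed over the support of \<open>p\<close>, where each monomial value gains one factor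
  \<open>x i\<close>.\<close>

lemma indexed_poly_eval_pmult:
  assumes "R.carrier_coeff p" "finite {m. p m \<noteq> \<zero>}"
  shows "indexed_poly_eval R S h x (R.indexed_pmult p i) =
    indexed_poly_eval R S h x p \<otimes>\<^bsub>S\<^esub> x i"
proof -
  let ?F = "{m. p m \<noteq> \<zero>}"
  let ?t = "\<lambda>p m. h (p m) \<otimes>\<^bsub>S\<^esub> monomial_eval S x m"
  have val: "p m \<in> carrier R" for m
    using assms by (auto simp: R.carrier_coeff_def)
  have xi: "x i \<in> carrier S" using x by auto
  have sub: "{m. R.indexed_pmult p i m \<noteq> \<zero>} \<subseteq> add_mset i ` ?F"
  proof
    fix m assume "m \<in> {m. R.indexed_pmult p i m \<noteq> \<zero>}"
    then have "i \<in># m" "p (m - {#i#}) \<noteq> \<zero>"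
      by (auto simp: R.indexed_pmult_def split: if_splits)
    then show "m \<in> add_mset i ` ?F"
      by (intro image_eqI[of _ _ "m - {#i#}"]) auto
  qed
  have "indexed_poly_eval R S h x (R.indexed_pmult p i) =
      finsum S (?t (R.indexed_pmult p i)) (add_mset i ` ?F)"
    by (rule indexed_poly_eval_superset)
      (use assms sub in \<open>auto simp: R.indexed_pmult_in_carrier\<close>)
  also have "\<dots> = finsum S (\<lambda>m. ?t (R.indexed_pmult p i) (add_mset i m)) ?F"
    by (rule S.finsum_reindex) (use val x in \<open>auto simp: R.indexed_pmult_def inj_on_def\<close>)
  also have "\<dots> = finsum S (\<lambda>m. ?t p m \<otimes>\<^bsub>S\<^esub> x i) ?F"
    by (rule S.finsum_cong')
      (use val x xi in \<open>auto simp: R.indexed_pmult_def S.monomial_eval_add_mset S.m_assoc\<close>)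
  also have "\<dots> = finsum S (?t p) ?F \<otimes>\<^bsub>S\<^esub> x i"
    by (rule S.finsum_ldistr[symmetric]) (use assms val x xi in auto)
  finally show ?thesis by (simp add: indexed_poly_eval_def)
qed

text \<open>Multiplying by a constant polynomial is scaling, so this serves as the base case of
  multiplicativity.\<close>

lemma indexed_poly_eval_scale:
  assumes "k \<in> carrier R" "R.carrier_coeff p" "finite {m. p m \<noteq> \<zero>}"
  shows "indexed_poly_eval R S h x (\<lambda>m. k \<otimes> p m) = h k \<otimes>\<^bsub>S\<^esub> indexed_poly_eval R S h x p"
proof -
  let ?F = "{m. p m \<noteq> \<zero>}"
  let ?t = "\<lambda>p m. h (p m) \<otimes>\<^bsub>S\<^esub> monomial_eval S x m"
  have val: "p m \<in> carrier R" for m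
    using assms by (auto simp: R.carrier_coeff_def)
  have "indexed_poly_eval R S h x (\<lambda>m. k \<otimes> p m) = finsum S (?t (\<lambda>m. k \<otimes> p m)) ?F"
    by (rule indexed_poly_eval_superset) (use assms val in \<open>auto simp: R.carrier_coeff_def\<close>)
  also have "\<dots> = finsum S (\<lambda>m. h k \<otimes>\<^bsub>S\<^esub> ?t p m) ?F"
    by (rule S.finsum_cong') (use assms val x in \<open>auto simp: S.m_assoc\<close>)
  also have "\<dots> = h k \<otimes>\<^bsub>S\<^esub> finsum S (?t p) ?F"
    by (rule S.finsum_rdistr[symmetric]) (use assms val x in auto)
  finally show ?thesis by (simp add: indexed_poly_eval_def)
qed

text \<open>Multiplicativity goes by induction on how the first factor is generated. The Cauchy
  product commutes with constants, sums and multiplication by a variable in that factor, so no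
  double sum has to be rearranged.\<close>

lemma indexed_poly_eval_ring_hom:
  "indexed_poly_eval R S h x \<in> ring_hom (indexed_poly_ring R I) S"
proof -
  let ?P = "R.indexed_pset I (carrier R)"
  let ?e = "indexed_poly_eval R S h x"
  interpret P: cring "indexed_poly_ring R I" by (rule R.indexed_poly_ring_cring)
  have cc: "R.carrier_coeff p" if "p \<in> ?P" for p :: "'i multiset \<Rightarrow> 'a"
    using R.indexed_pset_in_carrier[OF subset_refl that] .
  \<comment> \<open>Closure gives products finite support, as additivity and the variable rule
    demand.\<close>
  have closed: "poly_ring_mult R p q \<in> ?P" if "p \<in> ?P" "q \<in> ?P" for p q
    using P.m_closed[of p q] that by (simp add: indexed_poly_ring_def)
  have fin: "finite {m. p m \<noteq> \<zero>}" if "p \<in> ?P" for p :: "'i multiset \<Rightarrow> 'a"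
    using R.finite_indexed_poly_support[OF that] .
  have xc: "x i \<in> carrier S" for i using x by auto
  have mult: "?e (poly_ring_mult R p q) = ?e p \<otimes>\<^bsub>S\<^esub> ?e q" if "p \<in> ?P" "q \<in> ?P" for p q
    using that(1)
  proof induction
    case (indexed_const k)
    with that(2) show ?case
      by (simp add: R.poly_ring_mult_const cc fin indexed_poly_eval_scale indexed_poly_eval_const)
  next
    case (indexed_padd p p')
    with that(2) show ?case
      by (simp add: R.poly_ring_mult_padd cc fin closed indexed_poly_eval_padd
          indexed_poly_eval_closed S.l_distr)
  next
    case (indexed_pmult p i)
    with that(2) show ?case
      by (simp add: R.poly_ring_mult_pmult cc fin closed indexed_poly_eval_pmult
          indexed_poly_eval_closed xc S.m_ac)
  qed
  show ?thesis
    by (rule ring_hom_memI)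
      (auto simp: indexed_poly_ring_def mult cc fin indexed_poly_eval_closed
        indexed_poly_eval_padd indexed_poly_eval_const)
qed

lemma indexed_poly_eval_var:
  "indexed_poly_eval R S h x (R.indexed_var i) = x i"
proof -
  let ?one = "R.indexed_const \<one> :: 'i multiset \<Rightarrow> 'a"
  have "R.carrier_coeff ?one"
    by (simp add: R.carrier_coeff_def R.indexed_const_def)
  moreover have "finite {m. ?one m \<noteq> \<zero>}"
    by (rule finite_subset[of _ "{{#}}"]) (auto simp: R.indexed_const_def)
  moreover have "x i \<in> carrier S" using x by auto
  ultimately show ?thesis
    by (simp add: R.indexed_var_def indexed_poly_eval_pmult indexed_poly_eval_const)
qed

end

text \<open>The universal property of the polynomial ring (existence part), with values prescribed
  only on the index set.\<close>

lemma indexed_poly_ring_universal: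
  assumes x: "x \<in> I \<rightarrow> carrier S"
  obtains e where "e \<in> ring_hom (indexed_poly_ring R I) S"
    and "\<And>k. k \<in> carrier R \<Longrightarrow> e (R.indexed_const k) = h k"
    and "\<And>i. i \<in> I \<Longrightarrow> e (R.indexed_var i) = x i"
proof -
  \<comment> \<open>Evaluation expects a value in the carrier at every index of the type; one is an
    arbitrary default outside \<open>I\<close>.\<close>
  let ?x = "\<lambda>i. if i \<in> I then x i else \<one>\<^bsub>S\<^esub>"
  have "range ?x \<subseteq> carrier S" using x by auto
  from indexed_poly_eval_ring_hom[OF this] indexed_poly_eval_const[OF this]
    indexed_poly_eval_var[OF this]
  show thesis by (intro that[of "indexed_poly_eval R S h ?x"]) auto
qed

end

section \<open>The bi-amalgamation as a commutative ring\<close>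

lemma RDirProd_cring:
  assumes "cring B" "cring C"
  shows "cring (RDirProd B C)"
proof -
  interpret B: cring B by fact
  interpret C: cring C by fact
  interpret P: ring "RDirProd B C" by (rule RDirProd_ring) unfold_locales
  show ?thesis
    by unfold_locales (auto simp: RDirProd_def DirProd_def monoid.defs B.m_comm C.m_comm)
qed

lemma bi_amalgamation_simps:
  "(b, c) \<oplus>\<^bsub>bi_amalgamation A B C f g J J'\<^esub> (b', c') = (b \<oplus>\<^bsub>B\<^esub> b', c \<oplus>\<^bsub>C\<^esub> c')"
  "(b, c) \<otimes>\<^bsub>bi_amalgamation A B C f g J J'\<^esub> (b', c') = (b \<otimes>\<^bsub>B\<^esub> b', c \<otimes>\<^bsub>C\<^esub> c')"
  "\<one>\<^bsub>bi_amalgamation A B C f g J J'\<^esub> = (\<one>\<^bsub>B\<^esub>, \<one>\<^bsub>C\<^esub>)"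
  "\<zero>\<^bsub>bi_amalgamation A B C f g J J'\<^esub> = (\<zero>\<^bsub>B\<^esub>, \<zero>\<^bsub>C\<^esub>)"
  by (simp_all add: bi_amalgamation_def RDirProd_def DirProd_def monoid.defs)

lemma bi_amalgamation_carrierI:
  assumes "a \<in> carrier A" "y \<in> J" "z \<in> J'"
  shows "(f a \<oplus>\<^bsub>B\<^esub> y, g a \<oplus>\<^bsub>C\<^esub> z) \<in> carrier (bi_amalgamation A B C f g J J')"
  using assms by (auto simp: bi_amalgamation_def)

lemma bi_amalgamation_cring:
  assumes "cring A" "cring B" "cring C" "f \<in> ring_hom A B" "g \<in> ring_hom A C"
    and "ideal J B" "ideal J' C"
  shows "cring (bi_amalgamation A B C f g J J')"
proof -
  interpret P: cring "RDirProd B C" using assms by (intro RDirProd_cring)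
  let ?S = "carrier (bi_amalgamation A B C f g J J')"
  have sub: "subring ?S (RDirProd B C)"
    using assms by (rule bi_amalgamation_subring)
  then have "cring (RDirProd B C \<lparr>carrier := ?S\<rparr>)"
    using P.subcringI' P.subcring_iff subringE(1) by blast
  then show ?thesis by (simp add: bi_amalgamation_def)
qed

section \<open>Induction over module generators\<close>

text \<open>The closure conditions make \<open>K\<close> a submodule containing the generators, and
  \<open>J\<close> is the intersection of all such submodules.\<close>

lemma ideal_module_generators_induct:
  assumes "cring A" "cring B" "f \<in> ring_hom A B" "ideal J B"
    and gen: "module_generated_by A (ideal_module f B J) x I"
    and K: "K \<subseteq> J" "\<zero>\<^bsub>B\<^esub> \<in> K" "\<And>y z. y \<in> K \<Longrightarrow> z \<in> K \<Longrightarrow> y \<oplus>\<^bsub>B\<^esub> z \<in> K"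
      "\<And>a y. a \<in> carrier A \<Longrightarrow> y \<in> K \<Longrightarrow> f a \<otimes>\<^bsub>B\<^esub> y \<in> K"
    and xK: "\<And>i. i \<in> I \<Longrightarrow> x i \<in> K"
  shows "J \<subseteq> K"
proof -
  interpret module A "ideal_module f B J"
    using assms by (intro ideal_module_is_module)
  have "submodule K A (ideal_module f B J)"
  proof (rule submoduleI)
    fix y assume y: "y \<in> K"
    with K(1) have yJ: "y \<in> carrier (ideal_module f B J)" by (auto simp: ideal_module_def)
    \<comment> \<open>Closure under negation comes from the scalar action of minus one.\<close>
    then have "\<ominus>\<^bsub>ideal_module f B J\<^esub> y = (\<ominus>\<^bsub>A\<^esub> \<one>\<^bsub>A\<^esub>) \<odot>\<^bsub>ideal_module f B J\<^esub> y"
      by (simp add: smult_l_minus)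
    with y show "\<ominus>\<^bsub>ideal_module f B J\<^esub> y \<in> K"
      using K(4)[of "\<ominus>\<^bsub>A\<^esub> \<one>\<^bsub>A\<^esub>" y] by (simp add: ideal_module_def)
  qed (use K in \<open>auto simp: ideal_module_def\<close>)
  moreover have "x ` I \<subseteq> K"
    using xK by blast
  moreover have "J = \<Inter> {H. submodule H A (ideal_module f B J) \<and> x ` I \<subseteq> H}"
    using gen by (simp add: module_generated_by_def) (simp add: ideal_module_def)
  ultimately show ?thesis by blast
qed

section \<open>The surjection onto the bi-amalgamation\<close>

theorem proposition5p1:
  fixes A :: "('a, 'r) ring_scheme" and B :: "('b, 's) ring_scheme" and C :: "('c, 't) ring_scheme"
    and f :: "'a \<Rightarrow> 'b" and g :: "'a \<Rightarrow> 'c"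
    and J :: "'b set" and J' :: "'c set"
    and M :: "'m set" and N :: "'n set"
    and j :: "'m \<Rightarrow> 'b" and j' :: "'n \<Rightarrow> 'c"
  assumes "cring A" and "cring B" and "cring C"
    and "f \<in> ring_hom A B" and "g \<in> ring_hom A C"
    and "ideal J B" and "ideal J' C"
    and "{a \<in> carrier A. f a \<in> J} = {a \<in> carrier A. g a \<in> J'}"
    and "module_generated_by A (ideal_module f B J) j M"
    and "module_generated_by A (ideal_module g C J') j' N"
  shows "\<exists>h \<in> ring_hom (indexed_poly_ring A (M <+> N)) (bi_amalgamation A B C f g J J').
           h ` carrier (indexed_poly_ring A (M <+> N)) =
             carrier (bi_amalgamation A B C f g J J')"
proof -
  interpret A: cring A by fact
  interpret B: cring B by fact
  interpret C: cring C by fact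
  interpret J: ideal J B by fact
  interpret J': ideal J' C by fact
  interpret f: ring_hom_cring A B f using assms(4) by unfold_locales
  interpret g: ring_hom_cring A C g using assms(5) by unfold_locales
  let ?S = "bi_amalgamation A B C f g J J'"
  let ?P = "indexed_poly_ring A (M <+> N)"
  let ?h = "\<lambda>a. (f a, g a)"
  let ?x = "case_sum (\<lambda>\<mu>. (j \<mu>, \<zero>\<^bsub>C\<^esub>)) (\<lambda>\<nu>. (\<zero>\<^bsub>B\<^esub>, j' \<nu>))"
  interpret S: cring ?S using assms(1-7) by (rule bi_amalgamation_cring)
  interpret P: cring ?P by (rule A.indexed_poly_ring_cring)
  have J: "y \<in> carrier B" if "y \<in> J" for y using that by (rule J.Icarr)
  have J': "z \<in> carrier C" if "z \<in> J'" for z using that by (rule J'.Icarr)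
  have diag: "(f a, g a) \<in> carrier ?S" if "a \<in> carrier A" for a
    using bi_amalgamation_carrierI[of a A "\<zero>\<^bsub>B\<^esub>" J "\<zero>\<^bsub>C\<^esub>" J' B f C g] that by simp
  \<comment> \<open>Taking \<open>a\<close> to be zero puts the product of \<open>J\<close> and
    \<open>J'\<close> inside the bi-amalgamation, so the chosen values of the variables are
    admissible.\<close>
  have pair: "(y, z) \<in> carrier ?S" if "y \<in> J" "z \<in> J'" for y z
    using bi_amalgamation_carrierI[of "\<zero>\<^bsub>A\<^esub>" A y J z J' B f C g] that J J' by simp
  have "?h \<in> ring_hom A ?S"
    by (rule ring_hom_memI) (auto simp: diag bi_amalgamation_simps)
  then interpret h: ring_hom_cring A ?S ?h by unfold_locales
  have jM: "j \<mu> \<in> J" if "\<mu> \<in> M" for \<mu>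
    using assms(9) that by (auto simp: module_generated_by_def ideal_module_def)
  have jN: "j' \<nu> \<in> J'" if "\<nu> \<in> N" for \<nu>
    using assms(10) that by (auto simp: module_generated_by_def ideal_module_def)
  have "?x \<in> M <+> N \<rightarrow> carrier ?S"
    by (auto intro!: pair jM jN)
  then obtain e where e: "e \<in> ring_hom ?P ?S"
    and const: "\<And>a. a \<in> carrier A \<Longrightarrow> e (A.indexed_const a) = (f a, g a)"
    and var: "\<And>i. i \<in> M <+> N \<Longrightarrow> e (A.indexed_var i) = ?x i"
    by (rule h.indexed_poly_ring_universal[where x = ?x and I = "M <+> N"]) blast
  interpret e: ring_hom_cring ?P ?S e using e by unfold_locales
  let ?E = "e ` carrier ?P"
  \<comment> \<open>Surjectivity rests on the image being closed under sums and products and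
    containing the values of constants and variables.\<close>
  have add: "u \<oplus>\<^bsub>?S\<^esub> v \<in> ?E" if uv: "u \<in> ?E" "v \<in> ?E" for u v
  proof -
    from uv obtain p q where "p \<in> carrier ?P" "q \<in> carrier ?P" "u = e p" "v = e q" by auto
    then show ?thesis by (intro image_eqI[of _ _ "p \<oplus>\<^bsub>?P\<^esub> q"]) simp_all
  qed
  have mult: "u \<otimes>\<^bsub>?S\<^esub> v \<in> ?E" if uv: "u \<in> ?E" "v \<in> ?E" for u v
  proof -
    from uv obtain p q where "p \<in> carrier ?P" "q \<in> carrier ?P" "u = e p" "v = e q" by auto
    then show ?thesis by (intro image_eqI[of _ _ "p \<otimes>\<^bsub>?P\<^esub> q"]) simp_all
  qed
  have constE: "(f a, g a) \<in> ?E" if "a \<in> carrier A" for a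
    using that const[OF that]
    by (intro image_eqI[of _ _ "A.indexed_const a"])
      (auto simp: indexed_poly_ring_def intro: A.indexed_pset.indexed_const)
  have varE: "?x i \<in> ?E" if "i \<in> M <+> N" for i
    using that var[OF that]
    by (intro image_eqI[of _ _ "A.indexed_var i"])
      (auto simp: indexed_poly_ring_def A.indexed_var_def intro!: A.indexed_pset.intros)
  have zeroE: "(\<zero>\<^bsub>B\<^esub>, \<zero>\<^bsub>C\<^esub>) \<in> ?E"
    using constE[of "\<zero>\<^bsub>A\<^esub>"] by simp
  have "J \<subseteq> {y \<in> J. (y, \<zero>\<^bsub>C\<^esub>) \<in> ?E}"
  proof (rule ideal_module_generators_induct[OF assms(1,2,4,6,9)])
    fix \<mu> assume "\<mu> \<in> M"
    then show "j \<mu> \<in> {y \<in> J. (y, \<zero>\<^bsub>C\<^esub>) \<in> ?E}"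
      using varE[OF InlI] jM by simp
  next
    fix y z assume "y \<in> {y \<in> J. (y, \<zero>\<^bsub>C\<^esub>) \<in> ?E}" "z \<in> {y \<in> J. (y, \<zero>\<^bsub>C\<^esub>) \<in> ?E}"
    then show "y \<oplus>\<^bsub>B\<^esub> z \<in> {y \<in> J. (y, \<zero>\<^bsub>C\<^esub>) \<in> ?E}"
      using add[of "(y, \<zero>\<^bsub>C\<^esub>)" "(z, \<zero>\<^bsub>C\<^esub>)"] by (simp add: bi_amalgamation_simps J.a_closed)
  next
    \<comment> \<open>The scalar \<open>a\<close> acts as multiplication by the image
      \<open>(f a, g a)\<close> of a constant; the zero in the second component absorbs
      \<open>g a\<close>.\<close>
    fix a y assume "a \<in> carrier A" "y \<in> {y \<in> J. (y, \<zero>\<^bsub>C\<^esub>) \<in> ?E}"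
    then show "f a \<otimes>\<^bsub>B\<^esub> y \<in> {y \<in> J. (y, \<zero>\<^bsub>C\<^esub>) \<in> ?E}"
      using mult[of "(f a, g a)" "(y, \<zero>\<^bsub>C\<^esub>)"] constE[of a]
      by (simp add: bi_amalgamation_simps J.I_l_closed)
  qed (use zeroE in auto)
  then have JE: "(y, \<zero>\<^bsub>C\<^esub>) \<in> ?E" if "y \<in> J" for y
    using that by blast
  have "J' \<subseteq> {z \<in> J'. (\<zero>\<^bsub>B\<^esub>, z) \<in> ?E}"
  proof (rule ideal_module_generators_induct[OF assms(1,3,5,7,10)])
    fix \<nu> assume "\<nu> \<in> N"
    then show "j' \<nu> \<in> {z \<in> J'. (\<zero>\<^bsub>B\<^esub>, z) \<in> ?E}"
      using varE[OF InrI] jN by simp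
  next
    fix y z assume "y \<in> {z \<in> J'. (\<zero>\<^bsub>B\<^esub>, z) \<in> ?E}" "z \<in> {z \<in> J'. (\<zero>\<^bsub>B\<^esub>, z) \<in> ?E}"
    then show "y \<oplus>\<^bsub>C\<^esub> z \<in> {z \<in> J'. (\<zero>\<^bsub>B\<^esub>, z) \<in> ?E}"
      using add[of "(\<zero>\<^bsub>B\<^esub>, y)" "(\<zero>\<^bsub>B\<^esub>, z)"] by (simp add: bi_amalgamation_simps J'.a_closed)
  next
    fix a z assume "a \<in> carrier A" "z \<in> {z \<in> J'. (\<zero>\<^bsub>B\<^esub>, z) \<in> ?E}"
    then show "g a \<otimes>\<^bsub>C\<^esub> z \<in> {z \<in> J'. (\<zero>\<^bsub>B\<^esub>, z) \<in> ?E}"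
      using mult[of "(f a, g a)" "(\<zero>\<^bsub>B\<^esub>, z)"] constE[of a]
      by (simp add: bi_amalgamation_simps J'.I_l_closed)
  qed (use zeroE in auto)
  then have JE': "(\<zero>\<^bsub>B\<^esub>, z) \<in> ?E" if "z \<in> J'" for z
    using that by blast
  have "carrier ?S \<subseteq> ?E"
  proof
    fix s assume "s \<in> carrier ?S"
    then obtain a y z where s: "s = (f a \<oplus>\<^bsub>B\<^esub> y, g a \<oplus>\<^bsub>C\<^esub> z)"
      and a: "a \<in> carrier A" "y \<in> J" "z \<in> J'"
      by (auto simp: bi_amalgamation_def)
    have "s = (f a, g a) \<oplus>\<^bsub>?S\<^esub> ((y, \<zero>\<^bsub>C\<^esub>) \<oplus>\<^bsub>?S\<^esub> (\<zero>\<^bsub>B\<^esub>, z))"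
      using a J J' by (simp add: s bi_amalgamation_simps)
    with a show "s \<in> ?E"
      by (simp only:) (intro add constE JE JE')
  qed
  \<comment> \<open>The other inclusion holds because \<open>e\<close> maps into the carrier of its
    target.\<close>
  then have "?E = carrier ?S" by auto
  with e show ?thesis by blast
qed

end
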